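(* Let $t\in(0,1)$. There exist constants $0<c<C<\infty$, depending only on $t$, such that for all integers $n\ge 1$, $$\frac{c}{n^4}\le \kappa_n(\overline{\mathbb{D}},t)\le \kappa_n(\mathbb{T},t)\le \frac{C}{n},$$ and moreover, for all integers $n\ge 2$, $$\kappa_n(\mathbb{T},t)\ge \frac{c}{n^2\log n}.$$
   Context: $\mathbb{T}$ is the unit circle and $\overline{\mathbb{D}}$ the closed unit disc in $\mathbb{C}$. For compact $K\subseteq\mathbb{C}$, $\mathcal{P}_n(K)$ is the set of monic complex polynomials of degree $n$ all of whose zeros lie in $K$. For a polynomial $p$ and $t>0$, $\Lambda_p(t)=\{z\in\mathbb{C}: |p(z)|\le t\}$. $m$ is Lebesgue measure on $\mathbb{C}$, and $\kappa_n(K,t)=\inf\{m(\Lambda_p(t)): p\in\mathcal{P}_n(K)\}$. *)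

theory Defs
  imports "HOL-Analysis.Analysis" "HOL-Computational_Algebra.Polynomial"
begin

definition monic_polys :: "nat \<Rightarrow> complex set \<Rightarrow> complex poly set" where
  "monic_polys n K = {p. lead_coeff p = 1 \<and> degree p = n \<and> (\<forall>z. poly p z = 0 \<longrightarrow> z \<in> K)}"

definition lemniscate :: "complex poly \<Rightarrow> real \<Rightarrow> complex set" where
  "lemniscate p t = {z. norm (poly p z) \<le> t}"

text \<open>
  For \<open>n \<ge> 1\<close> every set \<open>lemniscate p t\<close> with \<open>p \<in> monic_polys n K\<close> is compact, so the
  real-valued \<open>measure\<close> is its true area. The infimum is over a set of reals bounded below
  by 0, and this set is nonempty whenever \<open>K\<close> is, so the real \<open>Inf\<close> is the true infimum.
\<close>
definition kappa :: "nat \<Rightarrow> complex set \<Rightarrow> real \<Rightarrow> real" where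
  "kappa n K t = (INF p\<in>monic_polys n K. measure lebesgue (lemniscate p t))"

end

theory Submission
  imports Defs "HOL-Complex_Analysis.Conformal_Mappings"
    "HOL-Computational_Algebra.Fundamental_Theorem_Algebra"
begin

text \<open>
  Every lower bound comes from the stronger estimate that the area of \<open>lemniscate p t\<close> is at
  least \<open>c / n\<^sup>2\<close> for all \<open>p\<close> of degree \<open>n\<close> with zeros in the closed disc.

  Let \<open>\<phi>\<close> be a bump function supported in the disc of radius \<open>t\<close>, written as the derivative in
  \<open>cnj w\<close> of a function that equals \<open>1 / w\<close> off that disc. By Green's theorem the integral of
  \<open>q \<cdot> \<phi>(p) \<cdot> cnj p'\<close> is the \<open>(n-1)\<close>-st coefficient of \<open>q\<close> times \<open>\<integral>\<phi>\<close>, whenever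
  \<open>degree q \<le> n - 1\<close>. Taking \<open>q = z ^ (n-1)\<close> and \<open>q = p'\<close> and combining by AM-GM yields
  \<open>\<integral>\<phi> \<le> n \<integral> \<phi>(p) \<bar>z\<bar> ^ (2n-2)\<close>. If the lemniscate lies in the disc of radius
  \<open>1 + (A + ln n / 2) / n\<close>, the weight \<open>\<bar>z\<bar> ^ (2n-2)\<close> is \<open>O(n)\<close> there and the estimate follows.

  Otherwise \<open>\<bar>p\<bar> \<le> t\<close> at some point at distance more than \<open>d = (A + ln n / 2) / n\<close> from the unit
  disc. Moving radially halfway to the circle makes \<open>\<bar>p\<bar>\<close> smaller by a factor \<open>exp (- n d / 6)\<close>.
  As \<open>- ln \<bar>p\<bar>\<close> is only polynomially large in \<open>n\<close> near this point, it cannot keep growing by a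
  constant factor over distances of order \<open>d / ln n\<close>; where it does not, Harnack's inequality for
  the harmonic function \<open>ln \<bar>p\<bar>\<close> produces a disc of radius of order \<open>1 / n\<close> in the lemniscate.

  The upper bound comes from \<open>z ^ n - 1\<close>, whose lemniscate lies in an annulus of width
  \<open>O(1 / n)\<close>.
\<close>

section \<open>Area integrals over the plane and Green's theorem\<close>

lemma continuous_on_Complex: "continuous_on S (\<lambda>w :: real \<times> real. Complex (fst w) (snd w))"
  by (simp add: Complex_eq) (intro continuous_intros)

lemma measurable_Complex:
  "(\<lambda>(x, y). Complex x y) \<in> (lborel :: (real \<times> real) measure) \<rightarrow>\<^sub>M lborel"
  using borel_measurable_continuous_onI[OF continuous_on_Complex] by (simp add: case_prod_beta')

text \<open>Lebesgue measure is determined by its values on boxes, and these agree. This moves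
  integrals to \<open>real \<times> real\<close>, where iterated integration is available.\<close>

lemma distr_lborel_Complex:
  "distr lborel lborel (\<lambda>(x, y). Complex x y) = (lborel :: complex measure)"
proof (rule lborel_eqI[symmetric])
  fix l u :: complex
  assume le: "\<And>b. b \<in> Basis \<Longrightarrow> l \<bullet> b \<le> u \<bullet> b"
  have "(\<lambda>(x, y). Complex x y) -` box l u \<inter> space lborel = box (Re l, Im l) (Re u, Im u)"
    by (auto simp: box_def Basis_complex_def Basis_prod_def inner_complex_def)
  moreover have "\<And>b. b \<in> Basis \<Longrightarrow> (Re l, Im l) \<bullet> b \<le> (Re u, Im u) \<bullet> b"
    using le[of 1] le[of \<i>] by (auto simp: Basis_complex_def Basis_prod_def inner_complex_def)
  ultimately show "emeasure (distr lborel lborel (\<lambda>(x, y). Complex x y)) (box l u) =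
      (\<Prod>b\<in>Basis. (u - l) \<bullet> b)"
    using emeasure_lborel_box[of "(Re l, Im l)" "(Re u, Im u)"]
    by (subst emeasure_distr[OF measurable_Complex])
      (simp_all add: Basis_complex_def Basis_prod_def inner_complex_def mult.commute)
qed simp

lemma integral_lborel_Complex:
  fixes f :: "complex \<Rightarrow> complex"
  assumes "continuous_on UNIV f"
  shows "(LINT z|lborel. f z) = (LINT w|lborel. f (Complex (fst w) (snd w)))"
proof -
  show ?thesis
    using borel_measurable_continuous_onI[OF assms]
    by (subst distr_lborel_Complex[symmetric], subst integral_distr[OF measurable_Complex])
       (simp_all add: case_prod_beta')
qed

text \<open>\<open>\<alpha>\<close> and \<open>\<beta>\<close> are the Wirtinger derivatives of
  \<open>H\<close> in \<open>z\<close> and \<open>cnj z\<close>. Over a square of half-side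
  \<open>R\<close> each real partial derivative of \<open>H\<close> integrates to boundary values of
  size \<open>B / R\<^sup>2\<close> along sides of length \<open>2 * R\<close>, hence to
  \<open>O(1 / R)\<close>. As \<open>\<beta>\<close> vanishes outside the square for large
  \<open>R\<close>, its integral does not depend on \<open>R\<close>.\<close>

lemma integral_dbar_eq_0:
  fixes H \<alpha> \<beta> :: "complex \<Rightarrow> complex"
  assumes deriv: "\<And>z. (H has_derivative (\<lambda>h. \<alpha> z * h + \<beta> z * cnj h)) (at z)"
    and c\<alpha>: "continuous_on UNIV \<alpha>" and c\<beta>: "continuous_on UNIV \<beta>"
    and decay: "\<And>z. norm z \<ge> R0 \<Longrightarrow> norm (H z) \<le> B / (norm z)\<^sup>2"
    and supp: "\<And>z. norm z \<ge> R0 \<Longrightarrow> \<beta> z = 0"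
  shows "(LINT z|lborel. \<beta> z) = 0"
proof -
  define I where "I = (LINT z|lborel. \<beta> z)"
  have bound: "norm I \<le> 4 * B / R" if R: "R \<ge> R0" "R > 0" for R
  proof -
    let ?Q = "cbox (-R, -R) (R, R) :: (real \<times> real) set"
    let ?C = "\<lambda>w :: real \<times> real. Complex (fst w) (snd w)"
    define F where "F = (\<lambda>x y. H (Complex x y))"
    have H_le: "norm (H z) \<le> B / R\<^sup>2" if "norm z \<ge> R" for z
    proof -
      have "norm (H z) \<le> B / (norm z)\<^sup>2"
        using decay that R by simp
      \<comment> \<open>The sign of \<open>B\<close> is read off from the decay bound at
        \<open>z\<close> itself; it is needed to replace \<open>norm z\<close> by
        \<open>R\<close>.\<close>
      moreover from this have "B \<ge> 0"
        using order_trans[OF norm_ge_zero, of "H z"] that R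
        by (force simp: zero_le_divide_iff)
      ultimately show ?thesis
        using that R by (smt (verit) frac_le power_mono zero_less_power)
    qed
    have comp: "continuous_on S (\<lambda>w. g (?C w))" if "continuous_on UNIV g" 
      for S and g :: "complex \<Rightarrow> complex"
      using continuous_on_compose2[OF that continuous_on_Complex] by simp
    have I: "I = integral ?Q (\<lambda>w. \<beta> (?C w))"
    proof -
      have "I = (LINT w|lborel. \<beta> (?C w))"
        unfolding I_def by (rule integral_lborel_Complex[OF c\<beta>])
      also have "\<dots> = (LINT w:?Q|lborel. \<beta> (?C w))"
        unfolding set_lebesgue_integral_def
      proof (rule Bochner_Integration.integral_cong[OF refl])
        fix w :: "real \<times> real"
        show "\<beta> (?C w) = indicator ?Q w *\<^sub>R \<beta> (?C w)"
        proof (cases "w \<in> ?Q")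
          case False
          then have "\<bar>fst w\<bar> > R \<or> \<bar>snd w\<bar> > R"
            by (cases w) (auto simp: cbox_Pair_eq)
          then have "norm (?C w) \<ge> R"
            using abs_Re_le_cmod[of "?C w"] abs_Im_le_cmod[of "?C w"] by auto
          then show ?thesis using supp R by simp
        qed simp
      qed
      also have "\<dots> = integral ?Q (\<lambda>w. \<beta> (?C w))"
        by (rule set_borel_integral_eq_integral(2))
           (unfold set_integrable_def, intro borel_integrable_compact compact_cbox comp c\<beta>)
      finally show ?thesis .
    qed
    have dx: "((\<lambda>x. F x y) has_vector_derivative (\<alpha> (Complex x y) + \<beta> (Complex x y))) (at x within S)" for x y S
    proof -
      have "((\<lambda>x. Complex x y) has_derivative (\<lambda>h. of_real h)) (at x within S)"
        by (simp add: Complex_eq) (auto intro!: derivative_eq_intros)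
      from has_derivative_compose[OF this deriv] show ?thesis
        unfolding F_def has_vector_derivative_def
        by (rule has_derivative_eq_rhs) (auto simp: scaleR_conv_of_real algebra_simps)
    qed
    have dy: "((\<lambda>y. F x y) has_vector_derivative (\<i> * (\<alpha> (Complex x y) - \<beta> (Complex x y)))) (at y within S)" for x y S
    proof -
      have "((\<lambda>y. Complex x y) has_derivative (\<lambda>h. \<i> * of_real h)) (at y within S)"
        by (simp add: Complex_eq) (auto intro!: derivative_eq_intros)
      from has_derivative_compose[OF this deriv] show ?thesis
        unfolding F_def has_vector_derivative_def
        by (rule has_derivative_eq_rhs) (auto simp: scaleR_conv_of_real algebra_simps)
    qed
    have ix: "integral (cbox (-R) R) (\<lambda>x. \<alpha> (Complex x y) + \<beta> (Complex x y)) = F R y - F (-R) y" for y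
      using fundamental_theorem_of_calculus[of "-R" R "\<lambda>x. F x y", OF _ dx] R
      by (intro integral_unique) auto
    have iy: "integral (cbox (-R) R) (\<lambda>y. \<i> * (\<alpha> (Complex x y) - \<beta> (Complex x y))) = F x R - F x (-R)" for x
      using fundamental_theorem_of_calculus[of "-R" R "\<lambda>y. F x y", OF _ dy] R
      by (intro integral_unique) auto
    have c1: "continuous_on S (\<lambda>w. \<alpha> (?C w) + \<beta> (?C w))" for S
      by (intro continuous_intros comp c\<alpha> c\<beta>)
    have c2: "continuous_on S (\<lambda>w. \<i> * (\<alpha> (?C w) - \<beta> (?C w)))" for S
      by (intro continuous_intros comp c\<alpha> c\<beta>)
    have B1: "norm (integral ?Q (\<lambda>w. \<alpha> (?C w) + \<beta> (?C w))) \<le> 4 * B / R"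
    proof -
      have "integral ?Q (\<lambda>w. \<alpha> (?C w) + \<beta> (?C w)) =
          integral (cbox (-R) R) (\<lambda>y. integral (cbox (-R) R) (\<lambda>x. \<alpha> (Complex x y) + \<beta> (Complex x y)))"
        using c1 integral_prod_continuous[OF c1, of "-R" "-R" R R]
          integral_swap_continuous[of "-R" "-R" R R "\<lambda>x y. \<alpha> (Complex x y) + \<beta> (Complex x y)"]
        by (simp add: case_prod_beta')
      also have "\<dots> = integral (cbox (-R) R) (\<lambda>y. F R y - F (-R) y)"
        by (simp only: ix)
      also have "norm \<dots> \<le> (2 * B / R\<^sup>2) * (R - (-R))"
      proof (subst cbox_interval, rule integral_bound)
        show "continuous_on {-R..R} (\<lambda>y. F R y - F (-R) y)"
          using dy by (intro continuous_intros) 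
            (meson has_vector_derivative_continuous continuous_on_eq_continuous_within)+
        fix y
        have "norm (F x y) \<le> B / R\<^sup>2" if "\<bar>x\<bar> = R" for x
          unfolding F_def using that abs_Re_le_cmod[of "Complex x y"] by (intro H_le) simp
        from this[of R] this[of "-R"] R show "norm (F R y - F (-R) y) \<le> 2 * B / R\<^sup>2"
          using norm_triangle_ineq4[of "F R y" "F (-R) y"] by simp
      qed (use R in simp)
      finally show ?thesis using R by (simp add: power2_eq_square)
    qed
    have B2: "norm (integral ?Q (\<lambda>w. \<i> * (\<alpha> (?C w) - \<beta> (?C w)))) \<le> 4 * B / R"
    proof -
      have "integral ?Q (\<lambda>w. \<i> * (\<alpha> (?C w) - \<beta> (?C w))) =
          integral (cbox (-R) R) (\<lambda>x. integral (cbox (-R) R) (\<lambda>y. \<i> * (\<alpha> (Complex x y) - \<beta> (Complex x y))))"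
        using integral_prod_continuous[OF c2, of "-R" "-R" R R] by simp
      also have "\<dots> = integral (cbox (-R) R) (\<lambda>x. F x R - F x (-R))"
        by (simp only: iy)
      also have "norm \<dots> \<le> (2 * B / R\<^sup>2) * (R - (-R))"
      proof (subst cbox_interval, rule integral_bound)
        show "continuous_on {-R..R} (\<lambda>x. F x R - F x (-R))"
          using dx by (intro continuous_intros) 
            (meson has_vector_derivative_continuous continuous_on_eq_continuous_within)+
        fix x
        have "norm (F x y) \<le> B / R\<^sup>2" if "\<bar>y\<bar> = R" for y
          unfolding F_def using that abs_Im_le_cmod[of "Complex x y"] by (intro H_le) simp
        from this[of R] this[of "-R"] R show "norm (F x R - F x (-R)) \<le> 2 * B / R\<^sup>2"
          using norm_triangle_ineq4[of "F x R" "F x (-R)"] by simp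
      qed (use R in simp)
      finally show ?thesis using R by (simp add: power2_eq_square)
    qed
    \<comment> \<open>Twice \<open>\<beta>\<close> is the x-derivative of \<open>H\<close> plus
      \<open>\<i>\<close> times its y-derivative.\<close>
    have "2 * I = integral ?Q (\<lambda>w. 2 * \<beta> (?C w))"
      unfolding I by (rule integral_mult_right[symmetric])
    also have "\<dots> = integral ?Q (\<lambda>w. (\<alpha> (?C w) + \<beta> (?C w)) + \<i> * (\<i> * (\<alpha> (?C w) - \<beta> (?C w))))"
      by (simp add: algebra_simps)
    also have "\<dots> = integral ?Q (\<lambda>w. \<alpha> (?C w) + \<beta> (?C w)) + 
        \<i> * integral ?Q (\<lambda>w. \<i> * (\<alpha> (?C w) - \<beta> (?C w)))"
      using integrable_continuous[OF c1] integrable_continuous[OF continuous_on_mult_left[OF c2]]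
      by (simp only: integral_add integral_mult_right)
    also have "norm \<dots> \<le> 4 * B / R + 4 * B / R"
      using B1 B2 by (intro order_trans[OF norm_triangle_ineq] add_mono) (simp_all add: norm_mult)
    finally show ?thesis by (simp add: norm_mult)
  qed
  have "((\<lambda>R. 4 * B / R) \<longlongrightarrow> 0) at_top"
    by (rule real_tendsto_divide_at_top[OF tendsto_const filterlim_ident])
  moreover have "\<forall>\<^sub>F R in at_top. norm I \<le> 4 * B / R"
    using eventually_ge_at_top[of R0] eventually_gt_at_top[of 0] by eventually_elim (rule bound)
  ultimately have "norm I \<le> 0"
    by (intro tendsto_lowerbound[of _ 0 at_top]) auto
  then show ?thesis by (simp add: I_def)
qed

section \<open>Elementary bounds for polynomials\<close>

lemma monic_polys_factor:
  assumes "p \<in> monic_polys n K"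
  obtains r where "\<And>i. i < n \<Longrightarrow> r i \<in> K" "\<And>z. poly p z = (\<Prod>i<n. z - r i)"
proof -
  obtain r where r: "smult (lead_coeff p) (\<Prod>i<degree p. [:- r i, 1:]) = p"
    by (rule complex_poly_decompose'[of p])
  moreover have "lead_coeff p = 1" "degree p = n"
    using assms unfolding monic_polys_def by blast+
  ultimately have "p = (\<Prod>i<n. [:- r i, 1:])"
    by (metis smult_1_left)
  then have eq: "poly p z = (\<Prod>i<n. z - r i)" for z
    by (simp add: poly_prod)
  moreover have "r i \<in> K" if "i < n" for i
  proof -
    have "poly p (r i) = 0"
      unfolding eq using that by (intro prod_zero) auto
    with assms show ?thesis by (simp add: monic_polys_def)
  qed
  ultimately show thesis using that by blast
qed

text \<open>Each factor \<open>z - r i\<close> has norm at least \<open>norm z - 1\<close>. This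
  bounds the lemniscate, gives the bump compact support, and keeps \<open>p\<close> away from 0
  outside the closed disc.\<close>

lemma norm_poly_ge:
  assumes "p \<in> monic_polys n (cball 0 1)" "norm z \<ge> 1"
  shows "(norm z - 1) ^ n \<le> norm (poly p z)"
proof -
  obtain r where r: "\<And>i. i < n \<Longrightarrow> r i \<in> cball 0 1" "\<And>z. poly p z = (\<Prod>i<n. z - r i)"
    using monic_polys_factor[OF assms(1)] by metis
  have "(norm z - 1) ^ n = (\<Prod>i<n. norm z - 1)" by simp
  also have "\<dots> \<le> (\<Prod>i<n. norm (z - r i))"
  proof (intro prod_mono conjI)
    fix i assume "i \<in> {..<n}"
    then show "norm z - 1 \<le> norm (z - r i)"
      using r(1)[of i] norm_triangle_ineq2[of z "r i"] by auto
  qed (use assms in auto)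
  finally show ?thesis by (simp add: r(2) prod_norm)
qed

lemma norm_poly_le_sum:
  fixes q :: "complex poly"
  assumes "degree q \<le> d" "norm z \<ge> 1"
  shows "norm (poly q z) \<le> (\<Sum>i\<le>d. norm (coeff q i)) * norm z ^ d"
proof -
  have "norm (poly q z) = norm (\<Sum>i\<le>degree q. coeff q i * z ^ i)"
    by (simp add: poly_altdef)
  also have "\<dots> \<le> (\<Sum>i\<le>degree q. norm (coeff q i) * norm z ^ d)"
    using assms by (intro sum_norm_le) (auto simp: norm_mult norm_power intro!: mult_left_mono power_increasing)
  also have "\<dots> \<le> (\<Sum>i\<le>d. norm (coeff q i) * norm z ^ d)"
    using assms by (intro sum_mono2) auto
  finally show ?thesis by (simp add: sum_distrib_right)
qed

section \<open>The bump function and its dbar-primitive\<close>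

text \<open>The function \<open>\<lambda>w. 1 / w\<close>, regularised inside the disc of radius \<open>sqrt T\<close> so as to be
  continuously differentiable; its Wirtinger derivative in \<open>cnj w\<close> is the bump \<open>disc_bump\<close>.\<close>

definition reg_eta :: "real \<Rightarrow> real \<Rightarrow> real" where
  "reg_eta T s = (if s \<le> T then 2 / T - s / T\<^sup>2 else 1 / s)"

definition reg_inverse :: "real \<Rightarrow> complex \<Rightarrow> complex" where
  "reg_inverse T w = of_real (reg_eta T ((norm w)\<^sup>2)) * cnj w"

definition disc_bump :: "real \<Rightarrow> complex \<Rightarrow> real" where
  "disc_bump T w = 2 / T * max 0 (1 - (norm w)\<^sup>2 / T)"

text \<open>The linear branch of \<open>reg_eta\<close> is the tangent line of \<open>1 / s\<close>
  at \<open>T\<close>, so the branches match to first order there. The \<open>max\<close> merges the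
  two derivative formulas.\<close>

lemma reg_eta_deriv:
  assumes "T > 0"
  shows "(reg_eta T has_real_derivative - 1 / (max s T)\<^sup>2) (at s)"
proof -
  have "((\<lambda>s. if s \<in> {..T} then 2 / T - s / T\<^sup>2 else 1 / s) has_vector_derivative
      (if s \<in> {..T} then - 1 / T\<^sup>2 else - 1 / s\<^sup>2)) (at s within UNIV)"
    using assms
    by (intro has_vector_derivative_If_within_closures[where T = "{T<..}"])
       (auto simp: has_real_derivative_iff_has_vector_derivative[symmetric] power2_eq_square
          intro!: derivative_eq_intros)
  then show ?thesis
    by (simp add: has_real_derivative_iff_has_vector_derivative reg_eta_def[abs_def] max_def
        split: if_splits)
qed

text \<open>Write \<open>\<eta>\<close> for \<open>reg_eta T\<close> and
  \<open>s = w * cnj w\<close>. The derivative of \<open>\<eta> s * cnj w\<close> in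
  \<open>cnj w\<close> is \<open>\<eta> s + s * \<eta>' s\<close>, which is
  \<open>disc_bump\<close>; the derivative in \<open>w\<close> is
  \<open>\<eta>' s * (cnj w)\<^sup>2\<close>.\<close>

lemma reg_inverse_has_derivative:
  assumes "T > 0"
  shows "(reg_inverse T has_derivative
    (\<lambda>h. of_real (- 1 / (max ((norm w)\<^sup>2) T)\<^sup>2) * (cnj w)\<^sup>2 * h + of_real (disc_bump T w) * cnj h)) (at w)"
proof -
  let ?d = "- 1 / (max ((norm w)\<^sup>2) T)\<^sup>2"
  have 1: "((\<lambda>w. reg_eta T (w \<bullet> w)) has_derivative (\<lambda>h. ?d * (2 * (w \<bullet> h)))) (at w)"
  proof -
    have "((\<lambda>w. w \<bullet> w) has_derivative (\<lambda>h. 2 * (w \<bullet> h))) (at w)"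
      by (auto intro!: derivative_eq_intros simp: inner_commute)
    from has_derivative_compose[OF this, of "reg_eta T" "(*) ?d"] show ?thesis
      using reg_eta_deriv[OF assms, of "(norm w)\<^sup>2"] 
      by (simp add: has_field_derivative_def power2_norm_eq_inner)
  qed
  have 2: "(reg_inverse T has_derivative (\<lambda>h. of_real (reg_eta T (w \<bullet> w)) * cnj h +
      of_real (?d * (2 * (w \<bullet> h))) * cnj w)) (at w)"
    unfolding reg_inverse_def[abs_def] power2_norm_eq_inner
    by (rule has_derivative_mult[OF has_derivative_of_real[OF 1[unfolded power2_norm_eq_inner]]
        has_derivative_cnj[OF has_derivative_ident]])
  have in2: "complex_of_real (2 * (w \<bullet> h)) = w * cnj h + cnj w * h" for h
    by (simp add: complex_eq_iff inner_complex_def)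
  have nn: "w * cnj w = of_real ((norm w)\<^sup>2)"
    using complex_norm_square[of w] by simp
  have b: "reg_eta T ((norm w)\<^sup>2) + ?d * (norm w)\<^sup>2 = disc_bump T w"
    using assms by (auto simp: reg_eta_def disc_bump_def max_def field_simps power2_eq_square)
  show ?thesis
  proof (rule has_derivative_eq_rhs[OF 2], rule ext)
    fix h
    have "of_real (reg_eta T (w \<bullet> w)) * cnj h + of_real (?d * (2 * (w \<bullet> h))) * cnj w =
      of_real (reg_eta T ((norm w)\<^sup>2)) * cnj h + of_real ?d * (w * cnj h + cnj w * h) * cnj w"
      by (simp only: in2[symmetric] of_real_mult power2_norm_eq_inner mult.assoc)
    also have "\<dots> = of_real ?d * (cnj w)\<^sup>2 * h + (of_real (reg_eta T ((norm w)\<^sup>2)) + of_real ?d * (w * cnj w)) * cnj h"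
    proof -
      have "f * cnj h + e * (w * cnj h + cnj w * h) * cnj w =
          e * (cnj w)\<^sup>2 * h + (f + e * (w * cnj w)) * cnj h" for e f
        by (simp add: algebra_simps power2_eq_square)
      then show ?thesis .
    qed
    also have "\<dots> = of_real ?d * (cnj w)\<^sup>2 * h + of_real (disc_bump T w) * cnj h"
      by (simp only: nn b[symmetric] of_real_add of_real_mult)
    finally show "of_real (reg_eta T (w \<bullet> w)) * cnj h + of_real (?d * (2 * (w \<bullet> h))) * cnj w =
      of_real ?d * (cnj w)\<^sup>2 * h + of_real (disc_bump T w) * cnj h" .
  qed
qed

lemma reg_inverse_eq:
  assumes "(norm w)\<^sup>2 > T" "T > 0"
  shows "reg_inverse T w = 1 / w"
proof -
  have "w \<noteq> 0" using assms by auto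
  then show ?thesis
    using assms complex_norm_square[of w] by (auto simp: reg_inverse_def reg_eta_def field_simps)
qed

lemma disc_bump_nonneg: "T > 0 \<Longrightarrow> disc_bump T w \<ge> 0"
  by (simp add: disc_bump_def)

lemma disc_bump_le: "T > 0 \<Longrightarrow> disc_bump T w \<le> 2 / T"
  by (simp add: disc_bump_def divide_right_mono)

lemma disc_bump_eq_0: "T > 0 \<Longrightarrow> (norm w)\<^sup>2 \<ge> T \<Longrightarrow> disc_bump T w = 0"
  by (simp add: disc_bump_def max_def field_simps)

lemma continuous_disc_bump [continuous_intros]:
  assumes "continuous_on S f"
  shows "continuous_on S (\<lambda>x. disc_bump T (f x))"
  unfolding disc_bump_def by (cases "T = 0") (auto intro!: continuous_intros assms)

lemma continuous_reg_inverse: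
  assumes "T > 0" "continuous_on S f"
  shows "continuous_on S (\<lambda>x. reg_inverse T (f x))"
  using continuous_on_compose2[OF _ assms(2), of UNIV "reg_inverse T"]
    has_derivative_continuous[OF reg_inverse_has_derivative[OF assms(1)]]
  by (auto simp: continuous_on_eq_continuous_at)

section \<open>From the integral identity to an area bound\<close>

lemma integrable_lborel_compact_support:
  fixes f :: "complex \<Rightarrow> 'b::{banach, second_countable_topology}"
  assumes "continuous_on UNIV f" "\<And>z. norm z > R \<Longrightarrow> f z = 0"
  shows "integrable lborel f"
proof -
  have "integrable lborel (\<lambda>z. indicator (cball 0 R) z *\<^sub>R f z)"
    by (intro borel_integrable_compact continuous_on_subset[OF assms(1)]) auto
  also have "(\<lambda>z. indicator (cball 0 R) z *\<^sub>R f z) = f"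
    using assms(2) by (force simp: indicator_def)
  finally show ?thesis .
qed

lemma bump_poly_eq_0:
  assumes "p \<in> monic_polys n (cball 0 1)" "0 < T" "T \<le> 1" "norm z \<ge> 2"
  shows "disc_bump T (poly p z) = 0"
proof -
  have "1 \<le> (norm z - 1) ^ n" using assms by simp
  also have "\<dots> \<le> norm (poly p z)" using norm_poly_ge assms by simp
  finally have "1 \<le> (norm (poly p z))\<^sup>2" by simp
  with assms show ?thesis by (intro disc_bump_eq_0) auto
qed

text \<open>Since \<open>p\<close> and \<open>q\<close> are holomorphic, the integrand is the
  derivative in \<open>cnj z\<close> of \<open>q\<close> times \<open>reg_inverse T\<close> of
  \<open>p\<close>. Near infinity this product is \<open>q / p\<close>, asymptotic to
  \<open>a / z\<close>; \<open>a * reg_inverse T z\<close> has the same behaviour and its derivative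
  in \<open>cnj z\<close> is \<open>a\<close> times the bump.\<close>

lemma integral_bump_poly:
  assumes p: "p \<in> monic_polys n (cball 0 1)" and n: "n \<ge> 1" and T: "0 < T" "T \<le> 1"
    and q: "degree q \<le> n - 1"
  shows "(LINT z|lborel. poly q z * of_real (disc_bump T (poly p z)) * cnj (poly (pderiv p) z)) =
    coeff q (n - 1) * of_real (LINT z|lborel. disc_bump T z)"
proof -
  define a where "a = coeff q (n - 1)"
  define A where "A = (\<lambda>w. complex_of_real (- 1 / (max ((norm w)\<^sup>2) T)\<^sup>2) * (cnj w)\<^sup>2)"
  \<comment> \<open>Subtracting \<open>a / z\<close> at infinity leaves decay of order \<open>1 / z\<^sup>2\<close>.\<close>
  define H where "H = (\<lambda>z. poly q z * reg_inverse T (poly p z) - a * reg_inverse T z)"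
  define \<alpha> where "\<alpha> = (\<lambda>z. poly (pderiv q) z * reg_inverse T (poly p z)
     + poly q z * A (poly p z) * poly (pderiv p) z - a * A z)"
  define \<beta>1 where "\<beta>1 = (\<lambda>z. poly q z * of_real (disc_bump T (poly p z)) * cnj (poly (pderiv p) z))"
  define \<beta>2 where "\<beta>2 = (\<lambda>z. complex_of_real (disc_bump T z))"
  have cA: "continuous_on S (\<lambda>x. A (f x))" if "continuous_on S f" for S and f :: "complex \<Rightarrow> complex"
    unfolding A_def using T that by (intro continuous_intros) auto
  have c\<beta>: "continuous_on UNIV \<beta>1" "continuous_on UNIV \<beta>2"
    unfolding \<beta>1_def \<beta>2_def by (intro continuous_intros)+
  \<comment> \<open>The power of 2 comes from \<open>norm z - 1 \<ge> norm z / 2\<close>, valid for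
    \<open>norm z \<ge> 3\<close>.\<close>
  define B where "B = (\<Sum>i\<le>n - 1. norm (coeff (pCons 0 q - smult a p) i)) * 2 ^ n"
  have "(LINT z|lborel. \<beta>1 z - a * \<beta>2 z) = 0"
  proof (rule integral_dbar_eq_0)
    fix z
    have dR: "(reg_inverse T has_derivative (\<lambda>h. A w * h + of_real (disc_bump T w) * cnj h)) (at w)" for w
      unfolding A_def by (rule reg_inverse_has_derivative[OF T(1)])
    have dp: "(poly r has_derivative (\<lambda>h. poly (pderiv r) z * h)) (at z)" for r :: "complex poly"
      using poly_DERIV[of r z] by (simp add: has_field_derivative_def)
    have "(H has_derivative (\<lambda>h. (poly q z * (A (poly p z) * (poly (pderiv p) z * h) + 
          of_real (disc_bump T (poly p z)) * cnj (poly (pderiv p) z * h)) 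
          + (poly (pderiv q) z * h) * reg_inverse T (poly p z))
         - a * (A z * h + of_real (disc_bump T z) * cnj h))) (at z)"
      unfolding H_def
      by (intro has_derivative_diff has_derivative_mult has_derivative_mult_right
          has_derivative_compose[OF dp dR] dp dR)
    then show "(H has_derivative (\<lambda>h. \<alpha> z * h + (\<beta>1 z - a * \<beta>2 z) * cnj h)) (at z)"
      by (rule has_derivative_eq_rhs) (auto simp: \<alpha>_def \<beta>1_def \<beta>2_def algebra_simps)
  next
    show "continuous_on UNIV \<alpha>"
      unfolding \<alpha>_def by (intro continuous_intros continuous_reg_inverse T cA)
    show "continuous_on UNIV (\<lambda>z. \<beta>1 z - a * \<beta>2 z)"
      by (intro continuous_intros c\<beta>)
  next
    fix z :: complex assume z: "norm z \<ge> 3"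
    have "1 < (2::real) ^ n" using n by simp
    also have "(2::real) ^ n \<le> (norm z - 1) ^ n" using z by (intro power_mono) auto
    also have "\<dots> \<le> norm (poly p z)" using norm_poly_ge[OF p] z by simp
    finally have p1: "norm (poly p z) > 1" .
    have z1: "1 < (norm z)\<^sup>2" "1 < (norm (poly p z))\<^sup>2"
      using z p1 by (auto simp: one_less_power)
    have "poly p z \<noteq> 0" "z \<noteq> 0" using p1 z by auto
    then have "H z = poly (pCons 0 q - smult a p) z / (z * poly p z)"
      using z1 T by (simp add: H_def reg_inverse_eq field_simps)
    also have "norm \<dots> = norm (poly (pCons 0 q - smult a p) z) / (norm z * norm (poly p z))"
      by (simp add: norm_divide norm_mult)
    also have "\<dots> \<le> ((\<Sum>i\<le>n - 1. norm (coeff (pCons 0 q - smult a p) i)) * norm z ^ (n - 1)) / (norm z * (norm z / 2) ^ n)"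
    proof (intro frac_le mult_mono norm_poly_le_sum)
      \<comment> \<open>The coefficients of \<open>z ^ n\<close> in \<open>z * q\<close> and
        \<open>a * p\<close> are both \<open>a\<close> and cancel.\<close>
      show "degree (pCons 0 q - smult a p) \<le> n - 1"
      proof (rule degree_le, intro allI impI)
        fix i assume i: "n - 1 < i"
        show "coeff (pCons 0 q - smult a p) i = 0"
        proof (cases "i = n")
          case True
          then show ?thesis using p n by (cases n) (auto simp: monic_polys_def a_def)
        next
          case False
          with i have "i > n" by simp
          then show ?thesis using p q n
            by (cases i) (auto simp: monic_polys_def coeff_eq_0)
        qed
      qed
      have "(norm z / 2) ^ n \<le> (norm z - 1) ^ n" using z by (intro power_mono) auto
      also have "\<dots> \<le> norm (poly p z)" using norm_poly_ge[OF p] z by simp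
      finally show "(norm z / 2) ^ n \<le> norm (poly p z)" .
      have "norm z > 0" using z by linarith
      then show "0 < norm z * (norm z / 2) ^ n"
        by simp
    qed (use z in \<open>auto intro!: mult_nonneg_nonneg sum_nonneg\<close>)
    also have "\<dots> = B / (norm z)\<^sup>2"
      using n \<open>z \<noteq> 0\<close> unfolding B_def
      by (cases n) (simp_all add: field_simps power2_eq_square)
    finally show "norm (H z) \<le> B / (norm z)\<^sup>2" .
    have "disc_bump T z = 0"
      using z1 T by (intro disc_bump_eq_0) auto
    then show "\<beta>1 z - a * \<beta>2 z = 0"
      using bump_poly_eq_0[OF p T, of z] z by (simp add: \<beta>1_def \<beta>2_def)
  qed
  moreover have "integrable lborel \<beta>1"
    by (rule integrable_lborel_compact_support[OF c\<beta>(1), of 2])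
       (use bump_poly_eq_0[OF p T] in \<open>auto simp: \<beta>1_def\<close>)
  moreover have "integrable lborel \<beta>2"
  proof (rule integrable_lborel_compact_support[OF c\<beta>(2), of 1])
    fix z :: complex assume "norm z > 1"
    then have "(norm z)\<^sup>2 \<ge> T" using T one_le_power[of "norm z" 2] by linarith
    then show "\<beta>2 z = 0" using T by (simp add: \<beta>2_def disc_bump_eq_0)
  qed
  ultimately have "(LINT z|lborel. \<beta>1 z) = a * (LINT z|lborel. \<beta>2 z)"
    by simp
  then show ?thesis by (simp add: \<beta>1_def \<beta>2_def a_def)
qed

lemma compact_lemniscate:
  assumes p: "p \<in> monic_polys n (cball 0 1)" and n: "n \<ge> 1" and t: "t < 1"
  shows "compact (lemniscate p t)" "lemniscate p t \<subseteq> cball 0 2"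
proof -
  show sub: "lemniscate p t \<subseteq> cball 0 2"
  proof
    fix z assume z: "z \<in> lemniscate p t"
    show "z \<in> cball 0 2"
    proof (rule ccontr)
      assume "z \<notin> cball 0 2"
      then have "norm z > 2" by simp
      then have "1 \<le> (norm z - 1) ^ n" by simp
      also have "\<dots> \<le> norm (poly p z)" using norm_poly_ge[OF p] \<open>norm z > 2\<close> by simp
      finally show False using z t by (simp add: lemniscate_def)
    qed
  qed
  have "closed (lemniscate p t)"
    unfolding lemniscate_def by (intro closed_Collect_le continuous_intros)
  moreover have "bounded (lemniscate p t)"
    using sub bounded_cball bounded_subset by blast
  ultimately show "compact (lemniscate p t)"
    by (simp add: compact_eq_bounded_closed)
qed

lemma integral_disc_bump_pos:
  assumes T: "T > 0"
  shows "(LINT z|lborel. disc_bump T z) > 0"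
proof -
  \<comment> \<open>On this disc \<open>(norm z)\<^sup>2 / T \<le> 1 / 2\<close>, so the bump is at
    least \<open>1 / T\<close>.\<close>
  define r where "r = sqrt (T / 2)"
  have r: "r > 0" using T by (simp add: r_def)
  have int: "integrable lborel (disc_bump T)"
  proof (rule integrable_lborel_compact_support)
    show "continuous_on UNIV (disc_bump T)"
      using continuous_disc_bump[OF continuous_on_id] by simp
    show "disc_bump T z = 0" if "norm z > sqrt T" for z
      using T that by (intro disc_bump_eq_0) (simp_all add: real_sqrt_le_iff' less_imp_le real_le_lsqrt real_less_lsqrt sqrt_le_D)
  qed
  have fin: "emeasure lborel (ball (0::complex) r) < \<infinity>"
    using emeasure_lborel_ball_finite .
  have "0 < measure lborel (ball (0::complex) r)" using r by simp
  then have "0 < 1 / T * measure lborel (ball (0::complex) r)" using T by simp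
  also have "\<dots> = (LINT z|lborel. 1 / T * indicator (ball (0::complex) r) z)"
    using fin by simp
  also have "\<dots> \<le> (LINT z|lborel. disc_bump T z)"
  proof (rule integral_mono[OF _ int])
    show "integrable lborel (\<lambda>z. 1 / T * indicator (ball (0::complex) r) z)"
      using fin by (intro integrable_mult_right integrable_real_indicator) auto
    fix z :: complex
    show "1 / T * indicator (ball 0 r) z \<le> disc_bump T z"
    proof (cases "z \<in> ball 0 r")
      case True
      then have "(norm z)\<^sup>2 \<le> r\<^sup>2" by (intro power_mono) auto
      then have "(norm z)\<^sup>2 / T \<le> 1 / 2" using T by (simp add: r_def field_simps)
      then have "1 / T \<le> 2 / T * (1 - (norm z)\<^sup>2 / T)" 
        using mult_left_mono[of "1/2" "1 - (norm z)\<^sup>2 / T" "2 / T"] T by simp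
      also have "\<dots> \<le> disc_bump T z"
        unfolding disc_bump_def using T by (intro mult_left_mono) auto
      finally show ?thesis using True by simp
    next
      case False
      then show ?thesis using disc_bump_nonneg[OF T] by simp
    qed
  qed
  finally show ?thesis .
qed

text \<open>The choice \<open>q = p'\<close> evaluates the integral of
  \<open>\<phi> * (norm p')\<^sup>2\<close> exactly as \<open>n * k\<close>; the choice
  \<open>q = z ^ (n-1)\<close> bounds \<open>k\<close> by a mixed integral that AM-GM splits into
  this one and \<open>J\<close>. With \<open>T = t\<^sup>2\<close> the bump of \<open>p\<close>
  vanishes off the lemniscate, which bounds \<open>J\<close> by the area.\<close>

lemma integral_bump_le_area:
  assumes p: "p \<in> monic_polys n (cball 0 1)" and n: "n \<ge> 1" and t: "0 < t" "t < 1"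
    and R: "R \<ge> 1" "lemniscate p t \<subseteq> cball 0 R"
  shows "(LINT z|lborel. disc_bump (t\<^sup>2) z) \<le>
    n * (2 / t\<^sup>2 * R ^ (2 * n) * measure lebesgue (lemniscate p t))"
proof -
  define T where "T = t\<^sup>2"
  have T: "0 < T" "T \<le> 1" using t by (auto simp: T_def power_le_one)
  define k where "k = (LINT z|lborel. disc_bump T z)"
  define \<phi> where "\<phi> = (\<lambda>z. disc_bump T (poly p z))"
  define J where "J = (LINT z|lborel. \<phi> z * norm z ^ (2 * (n - 1)))"
  let ?p' = "\<lambda>z. poly (pderiv p) z"
  have \<phi>0: "\<phi> z = 0" if "norm z > 2" for z
    unfolding \<phi>_def using that by (intro bump_poly_eq_0[OF p T]) simp
  have \<phi>ge: "\<phi> z \<ge> 0" for z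
    unfolding \<phi>_def by (rule disc_bump_nonneg[OF T(1)])
  have int: "integrable lborel (\<lambda>z. \<phi> z * f z)" if "continuous_on UNIV f" for f :: "complex \<Rightarrow> real"
  proof (rule integrable_lborel_compact_support[where R = 2])
    show "continuous_on UNIV (\<lambda>z. \<phi> z * f z)"
      unfolding \<phi>_def by (intro continuous_intros that)
  qed (simp add: \<phi>0)
  have degp: "degree (pderiv p) \<le> n - 1"
    using p by (simp add: degree_pderiv monic_polys_def)
  have "coeff (pderiv p) (n - 1) = of_nat n"
    using p n by (cases n) (auto simp: coeff_pderiv monic_polys_def)
  then have "(LINT z|lborel. ?p' z * of_real (\<phi> z) * cnj (?p' z)) = of_nat n * of_real k"
    using integral_bump_poly[OF p n T degp] by (simp add: k_def \<phi>_def)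
  also have "(\<lambda>z. ?p' z * of_real (\<phi> z) * cnj (?p' z)) = (\<lambda>z. of_real (\<phi> z * (norm (?p' z))\<^sup>2))"
    by (rule ext) (simp add: complex_norm_square[symmetric] mult_ac del: of_real_power)
  also have "(LINT z|lborel. complex_of_real (\<phi> z * (norm (?p' z))\<^sup>2)) =
      of_real (LINT z|lborel. \<phi> z * (norm (?p' z))\<^sup>2)"
    by (rule integral_complex_of_real)
  finally have "complex_of_real (LINT z|lborel. \<phi> z * (norm (?p' z))\<^sup>2) = of_real (of_nat n * k)"
    by simp
  then have E: "(LINT z|lborel. \<phi> z * (norm (?p' z))\<^sup>2) = n * k"
    by (simp only: of_real_eq_iff)
  have "(LINT z|lborel. z ^ (n - 1) * of_real (\<phi> z) * cnj (?p' z)) = of_real k"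
    using integral_bump_poly[OF p n T, of "monom 1 (n - 1)"] 
    by (simp add: k_def \<phi>_def degree_monom_eq poly_monom)
  then have "k \<le> norm (LINT z|lborel. z ^ (n - 1) * of_real (\<phi> z) * cnj (?p' z))"
    by simp
  also have "\<dots> \<le> (LINT z|lborel. norm (z ^ (n - 1) * of_real (\<phi> z) * cnj (?p' z)))"
    by (rule integral_norm_bound)
  also have "\<dots> = (LINT z|lborel. \<phi> z * (norm z ^ (n - 1) * norm (?p' z)))"
    by (simp add: norm_mult norm_power \<phi>ge mult_ac)
  \<comment> \<open>The AM-GM weights make the \<open>p'\<close> term exactly \<open>k / 2\<close>,
    which the left side absorbs.\<close>
  also have "\<dots> \<le> (LINT z|lborel. n / 2 * (\<phi> z * norm z ^ (2 * (n - 1))) + 1 / (2 * n) * (\<phi> z * (norm (?p' z))\<^sup>2))"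
  proof (rule integral_mono)
    fix z
    define x y where "x = norm z ^ (n - 1)" and "y = norm (?p' z)"
    have "0 \<le> (n * x - y)\<^sup>2 / (2 * n)" by simp
    also have "\<dots> = n / 2 * x\<^sup>2 + 1 / (2 * n) * y\<^sup>2 - x * y"
      using n by (simp add: power2_eq_square field_simps)
    finally have "\<phi> z * (x * y) \<le> \<phi> z * (n / 2 * x\<^sup>2 + 1 / (2 * n) * y\<^sup>2)"
      by (intro mult_left_mono \<phi>ge) simp
    then show "\<phi> z * (norm z ^ (n - 1) * norm (?p' z)) \<le> n / 2 * (\<phi> z * norm z ^ (2 * (n - 1))) + 1 / (2 * n) * (\<phi> z * (norm (?p' z))\<^sup>2)"
      by (simp add: x_def y_def power_mult[symmetric] algebra_simps)
  qed (intro int Bochner_Integration.integrable_add integrable_mult_right continuous_intros)+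
  also have "\<dots> = n / 2 * J + 1 / (2 * n) * (n * k)"
    unfolding J_def E[symmetric]
    by (subst Bochner_Integration.integral_add)
       (intro int integrable_mult_right continuous_intros | simp)+
  also have "\<dots> = n / 2 * J + k / 2" using n by simp
  finally have "k \<le> n * J" by simp
  also have "J \<le> 2 / T * R ^ (2 * n) * measure lebesgue (lemniscate p t)"
  proof -
    have comp: "compact (lemniscate p t)" by (rule compact_lemniscate[OF p n t(2)])
    then have sets: "lemniscate p t \<in> sets lborel" 
      using borel_compact by auto
    have fin: "emeasure lborel (lemniscate p t) < \<infinity>"
      using comp emeasure_compact_finite by blast
    have "J \<le> (LINT z|lborel. 2 / T * R ^ (2 * n) * indicator (lemniscate p t) z)"
      unfolding J_def
    proof (rule integral_mono)
      show "integrable lborel (\<lambda>z. \<phi> z * norm z ^ (2 * (n - 1)))"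
        by (intro int continuous_intros)
      show "integrable lborel (\<lambda>z. 2 / T * R ^ (2 * n) * indicator (lemniscate p t) z)"
        using fin sets by (intro integrable_mult_right integrable_real_indicator) auto
      fix z
      show "\<phi> z * norm z ^ (2 * (n - 1)) \<le> 2 / T * R ^ (2 * n) * indicator (lemniscate p t) z"
      proof (cases "z \<in> lemniscate p t")
        case True
        then have "norm z \<le> R" using R by auto
        then have "norm z ^ (2 * (n - 1)) \<le> R ^ (2 * (n - 1))" by (intro power_mono) auto
        also have "\<dots> \<le> R ^ (2 * n)" using R by (intro power_increasing) auto
        finally have "\<phi> z * norm z ^ (2 * (n - 1)) \<le> 2 / T * R ^ (2 * n)"
          using disc_bump_le[OF T(1)] T unfolding \<phi>_def by (intro mult_mono) auto
        with True show ?thesis by simp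
      next
        case False
        then have "norm (poly p z) > t" by (simp add: lemniscate_def)
        then have "(norm (poly p z))\<^sup>2 \<ge> T" unfolding T_def using t by (intro power_mono) auto
        then show ?thesis using False T by (simp add: \<phi>_def disc_bump_eq_0)
      qed
    qed
    also have "\<dots> = 2 / T * R ^ (2 * n) * measure lebesgue (lemniscate p t)"
      using sets fin by simp
    finally show ?thesis .
  qed
  finally show ?thesis by (simp add: k_def T_def mult_left_mono)
qed

section \<open>Discs inside a lemniscate that reaches far out\<close>

text \<open>\<open>ln (norm f) + 3 * M\<close> is a positive harmonic function with value
  \<open>2 * M\<close> at the centre. Harnack's inequality for it follows from the Schwarz lemma for
  the Cayley transform \<open>F\<close>. On the disc of radius \<open>r / 9\<close> the Harnack
  factor is \<open>(1 + 1/9) / (1 - 1/9) = 5/4\<close>, which gives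
  \<open>5/2 * M - 3 * M = - M / 2\<close>.\<close>

lemma harnack_log_norm:
  fixes f :: "complex \<Rightarrow> complex"
  assumes hol: "f holomorphic_on ball a r" and nz: "\<And>w. w \<in> ball a r \<Longrightarrow> f w \<noteq> 0"
    and M: "M > 0" "ln (norm (f a)) = - M"
    and lower: "\<And>w. w \<in> ball a r \<Longrightarrow> ln (norm (f w)) > - 3 * M"
    and w: "w \<in> ball a (r / 9)"
  shows "ln (norm (f w)) \<le> - M / 2"
proof -
  have r: "r > 0"
  proof (rule ccontr)
    assume "\<not> r > 0"
    then have "ball a (r / 9) = {}" by (simp add: ball_empty)
    with w show False by simp
  qed
  have "contractible (ball a r)"
    by (simp add: convex_imp_contractible)
  from contractible_imp_holomorphic_log[OF hol this nz]
  obtain g where g: "g holomorphic_on ball a r" "\<And>w. w \<in> ball a r \<Longrightarrow> f w = exp (g w)"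
    by metis
  have Re: "Re (g w) = ln (norm (f w))" if "w \<in> ball a r" for w
    using g(2)[OF that] by simp
  \<comment> \<open>Subtracting the imaginary part at the centre makes \<open>h 0\<close> the real
    number \<open>c\<close>, so that \<open>F 0 = 0\<close>.\<close>
  define h where "h = (\<lambda>\<xi>. g (a + of_real r * \<xi>) + of_real (3 * M) - \<i> * of_real (Im (g a)))"
  define c where "c = complex_of_real (2 * M)"
  define F where "F = (\<lambda>\<xi>. (h \<xi> - c) / (h \<xi> + c))"
  have inb: "a + of_real r * \<xi> \<in> ball a r" if "norm \<xi> < 1" for \<xi>
    using that r by (simp add: dist_norm norm_mult)
  have hpos: "Re (h \<xi>) > 0" if "norm \<xi> < 1" for \<xi>
    using lower[OF inb[OF that]] Re[OF inb[OF that]] by (simp add: h_def)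
  have hc: "h \<xi> + c \<noteq> 0" if "norm \<xi> < 1" for \<xi>
    using hpos[OF that] M by (auto simp: c_def complex_eq_iff)
  have "h 0 = c"
    using Re[of a] r M by (simp add: h_def c_def complex_eq_iff)
  then have F0: "F 0 = 0" by (simp add: F_def)
  have holh: "h holomorphic_on ball 0 1"
  proof -
    have "(g \<circ> (\<lambda>\<xi>. a + of_real r * \<xi>)) holomorphic_on ball 0 1"
      by (rule holomorphic_on_compose_gen[OF _ g(1)]) (use inb in \<open>auto intro!: holomorphic_intros\<close>)
    then show ?thesis
      unfolding h_def by (auto intro!: holomorphic_intros simp: o_def)
  qed
  have holF: "F holomorphic_on ball 0 1"
    unfolding F_def using hc by (intro holomorphic_intros holh) (auto simp: c_def)
  have F1: "norm (F \<xi>) < 1" if "norm \<xi> < 1" for \<xi>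
  proof -
    have "(norm (h \<xi> - c))\<^sup>2 < (norm (h \<xi> + c))\<^sup>2"
      using mult_pos_pos[OF M(1) hpos[OF that]]
      unfolding cmod_power2 by (simp add: c_def power2_eq_square algebra_simps)
    then have "norm (h \<xi> - c) < norm (h \<xi> + c)"
      by (rule power2_less_imp_less) simp
    then show ?thesis
      using hc[OF that] by (simp add: F_def norm_divide)
  qed
  define \<xi> where "\<xi> = (w - a) / of_real r"
  have \<xi>: "norm \<xi> < 1 / 9"
    using w r by (simp add: \<xi>_def norm_divide dist_norm norm_minus_commute field_simps)
  have F9: "norm (F \<xi>) < 1 / 9"
    using Schwarz_Lemma(1)[OF holF F0 F1, of \<xi>] \<xi> by simp
  have "h \<xi> * (1 - F \<xi>) = c * (1 + F \<xi>)"
    using hc[of \<xi>] \<xi> by (simp add: F_def field_simps)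
  then have "norm (h \<xi>) * norm (1 - F \<xi>) = 2 * M * norm (1 + F \<xi>)"
    using M by (simp add: c_def norm_mult flip: norm_mult[of "h \<xi>"])
  moreover have "norm (1 - F \<xi>) \<ge> 8 / 9" "norm (1 + F \<xi>) \<le> 10 / 9"
    using norm_triangle_ineq2[of 1 "F \<xi>"] norm_triangle_ineq[of 1 "F \<xi>"] F9 by auto
  ultimately have "norm (h \<xi>) * (8 / 9) \<le> 2 * M * (10 / 9)"
    using M by (smt (verit, best) mult_left_mono norm_ge_zero)
  then have "Re (h \<xi>) \<le> 5 / 2 * M"
    using complex_Re_le_cmod[of "h \<xi>"] by simp
  moreover have "Re (h \<xi>) = ln (norm (f w)) + 3 * M"
    using Re[of w] w r by (simp add: h_def \<xi>_def)
  ultimately show ?thesis by simp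
qed

text \<open>The extremal case is \<open>\<zeta> = - e\<close>, with equality. After squaring, the
  difference of the sides is a nonnegative combination of \<open>1 - s\<close> and
  \<open>1 + x\<close>, both of which vanish there.\<close>

lemma norm_diff_radial:
  fixes e \<zeta> :: "'a::real_inner"
  assumes e: "norm e = 1" and \<zeta>: "norm \<zeta> \<le> 1" and r: "1 \<le> r" "r \<le> R"
  shows "(R + 1) * norm (r *\<^sub>R e - \<zeta>) \<le> (r + 1) * norm (R *\<^sub>R e - \<zeta>)"
proof -
  define x where "x = e \<bullet> \<zeta>"
  define s where "s = (norm \<zeta>)\<^sup>2"
  have s: "s \<le> 1" unfolding s_def using \<zeta> by (simp add: power_le_one)
  have "\<bar>x\<bar> \<le> norm e * norm \<zeta>" unfolding x_def by (rule Cauchy_Schwarz_ineq2)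
  with e \<zeta> have x: "x \<ge> -1" by simp
  have nrm: "(norm (u *\<^sub>R e - \<zeta>))\<^sup>2 = u\<^sup>2 - 2 * u * x + s" for u
  proof -
    have sub: "u * (u * (e \<bullet> e) - e \<bullet> \<zeta>) - (u * (e \<bullet> \<zeta>) - \<zeta> \<bullet> \<zeta>) =
        u * (u * (e \<bullet> e)) - 2 * u * (e \<bullet> \<zeta>) + \<zeta> \<bullet> \<zeta>"
      by (simp add: algebra_simps)
    have "(norm (u *\<^sub>R e - \<zeta>))\<^sup>2 = u * (u * (e \<bullet> e)) - 2 * u * (e \<bullet> \<zeta>) + \<zeta> \<bullet> \<zeta>"
      unfolding power2_norm_eq_inner inner_diff inner_scaleR_left inner_scaleR_right inner_commute[of \<zeta> e]
      by (rule sub)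
    moreover have "e \<bullet> e = 1" using e by (simp add: norm_eq_1)
    ultimately show ?thesis
      by (simp add: x_def s_def power2_eq_square flip: power2_norm_eq_inner)
  qed
  have "(r + 1)\<^sup>2 * (R\<^sup>2 - 2 * R * x + s) - (R + 1)\<^sup>2 * (r\<^sup>2 - 2 * r * x + s) =
      ((R + 1)\<^sup>2 - (r + 1)\<^sup>2) * (1 - s) + 2 * ((R - r) * (r * R - 1)) * (x + 1)"
    by (simp add: power2_eq_square algebra_simps)
  moreover have "(r + 1)\<^sup>2 \<le> (R + 1)\<^sup>2" using r by (intro power_mono) auto
  moreover have "r * R \<ge> 1" using r mult_mono[of 1 r 1 R] by simp
  ultimately have "(R + 1)\<^sup>2 * (r\<^sup>2 - 2 * r * x + s) \<le> (r + 1)\<^sup>2 * (R\<^sup>2 - 2 * R * x + s)"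
    using s x r by (smt (verit) mult_nonneg_nonneg)
  then have "((R + 1) * norm (r *\<^sub>R e - \<zeta>))\<^sup>2 \<le> ((r + 1) * norm (R *\<^sub>R e - \<zeta>))\<^sup>2"
    by (simp add: power_mult_distrib nrm)
  then show ?thesis
    by (rule power2_le_imp_le) (use r in simp)
qed

lemma norm_poly_radial:
  assumes p: "p \<in> monic_polys n (cball 0 1)" and e: "norm e = 1" and r: "1 \<le> r" "r \<le> R"
  shows "norm (poly p (r *\<^sub>R e)) \<le> ((r + 1) / (R + 1)) ^ n * norm (poly p (R *\<^sub>R e))"
proof -
  obtain \<zeta> where \<zeta>: "\<And>i. i < n \<Longrightarrow> \<zeta> i \<in> cball 0 1" "\<And>z. poly p z = (\<Prod>i<n. z - \<zeta> i)"
    using monic_polys_factor[OF p] by metis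
  have "norm (poly p (r *\<^sub>R e)) = (\<Prod>i<n. norm (r *\<^sub>R e - \<zeta> i))"
    by (simp add: \<zeta>(2) prod_norm)
  also have "\<dots> \<le> (\<Prod>i<n. (r + 1) / (R + 1) * norm (R *\<^sub>R e - \<zeta> i))"
  proof (intro prod_mono conjI)
    fix i assume "i \<in> {..<n}"
    then show "norm (r *\<^sub>R e - \<zeta> i) \<le> (r + 1) / (R + 1) * norm (R *\<^sub>R e - \<zeta> i)"
      using norm_diff_radial[OF e _ r, of "\<zeta> i"] \<zeta>(1)[of i] r by (simp add: field_simps)
  qed auto
  also have "\<dots> = ((r + 1) / (R + 1)) ^ n * norm (poly p (R *\<^sub>R e))"
    by (simp only: prod.distrib prod_constant card_lessThan prod_norm \<zeta>(2))
  finally show ?thesis .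
qed

text \<open>\<open>A \<ge> 5\<close> makes \<open>U z0\<close> at least \<open>5 / 6\<close>, which
  confines the maximiser \<open>z1\<close>; \<open>A \<ge> - 6 * ln t\<close> makes
  \<open>U z0\<close> at least \<open>- 2 * ln t\<close>, so that half of it still means
  \<open>norm (poly p w) \<le> t\<close>.\<close>

lemma lemniscate_contains_ball:
  assumes p: "p \<in> monic_polys n (cball 0 1)" and n: "n \<ge> 1" and t: "0 < t" "t < 1"
    and A: "A \<ge> 5" "A \<ge> - 6 * ln t" and d: "d = (A + ln n / 2) / n"
    and z: "z \<in> lemniscate p t" "norm z > 1 + d"
  obtains c where "ball c (1 / (288 * real n)) \<subseteq> lemniscate p t"
proof -
  define l where "l = ln (real n)"
  have l: "l \<ge> 0" using n by (simp add: l_def)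
  have nd: "n * d = A + l / 2" using n by (simp add: d l_def)
  have d0: "d > 0" using l A n by (simp add: d l_def[symmetric])
  have d1: "d < 1"
  proof (rule ccontr)
    assume "\<not> d < 1"
    then have "1 \<le> (norm z - 1) ^ n" using z by (intro one_le_power) auto
    also have "\<dots> \<le> norm (poly p z)" using norm_poly_ge[OF p] z d0 by simp
    finally show False using z t by (simp add: lemniscate_def)
  qed
  define R where "R = norm z"
  define e where "e = z /\<^sub>R R"
  have R: "R > 1 + d" using z by (simp add: R_def)
  have e: "norm e = 1" "R *\<^sub>R e = z" using R d0 by (simp_all add: e_def R_def[symmetric])
  \<comment> \<open>This point is on the ray through \<open>z\<close>. The disc of radius
    \<open>d / 4\<close> about it stays at distance \<open>d / 4\<close> from the unit disc, so
    \<open>p\<close> has no zeros there.\<close>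
  define z0 where "z0 = (1 + d / 2) *\<^sub>R e"
  define U where "U = (\<lambda>w. - ln (norm (poly p w)))"
  have low: "norm (poly p w) \<ge> (d / 4) ^ n" "norm (poly p w) > 0" if "w \<in> cball z0 (d / 4)" for w
  proof -
    have "norm z0 = 1 + d / 2" using e d0 by (simp add: z0_def)
    then have "norm w \<ge> 1 + d / 4"
      using that norm_triangle_ineq2[of z0 "z0 - w"] by (simp add: dist_norm)
    then have "(d / 4) ^ n \<le> (norm w - 1) ^ n" using d0 by (intro power_mono) auto
    also have "\<dots> \<le> norm (poly p w)" using norm_poly_ge[OF p] \<open>norm w \<ge> 1 + d / 4\<close> d0 by simp
    finally show "norm (poly p w) \<ge> (d / 4) ^ n" .
    then show "norm (poly p w) > 0" 
      using d0 by (meson less_le_trans zero_less_power divide_pos_pos zero_less_numeral)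
  qed
  have U_le: "U w \<le> 4 * n / d" if "w \<in> cball z0 (d / 4)" for w
  proof -
    have "n * ln (d / 4) = ln ((d / 4) ^ n)" using d0 by (simp add: ln_realpow)
    also have "\<dots> \<le> ln (norm (poly p w))" using low[OF that] d0 by simp
    finally have "U w \<le> n * ln (4 / d)" 
      using d0 by (simp add: U_def ln_div algebra_simps)
    also have "\<dots> \<le> n * (4 / d)" using ln_le_minus_one[of "4 / d"] d0 by (intro mult_left_mono) auto
    finally show ?thesis by (simp add: mult.commute)
  qed
  have Uz0: "U z0 \<ge> n * d / 6 - ln t"
  proof -
    have "norm (poly p z0) \<le> ((1 + d / 2 + 1) / (R + 1)) ^ n * norm (poly p (R *\<^sub>R e))"
      unfolding z0_def by (rule norm_poly_radial[OF p e(1)]) (use d0 R in auto)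
    also have "\<dots> \<le> exp (- d / 6) ^ n * t"
    proof (intro mult_mono power_mono)
      have "(1 + d / 2 + 1) / (R + 1) \<le> (1 + d / 2 + 1) / (1 + d + 1)"
        using R d0 by (intro divide_left_mono) auto
      \<comment> \<open>Clearing the denominator reduces this to
        \<open>d * d \<le> d\<close>.\<close>
      also have "\<dots> \<le> 1 - d / 6"
      proof -
        have "d * d \<le> d * 1" using d0 d1 by (intro mult_left_mono) auto
        then show ?thesis using d0 by (simp add: field_simps)
      qed
      also have "\<dots> \<le> exp (- d / 6)" using exp_ge_add_one_self[of "- d / 6"] by simp
      finally show "(1 + d / 2 + 1) / (R + 1) \<le> exp (- d / 6)" .
    qed (use e z t d0 R in \<open>auto simp: lemniscate_def\<close>)
    finally have "norm (poly p z0) \<le> exp (- d / 6) ^ n * t" .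
    then have "ln (norm (poly p z0)) \<le> ln (exp (- d / 6) ^ n * t)"
      using low(2)[of z0] d0 t by (subst ln_le_cancel_iff) auto
    also have "\<dots> = - n * d / 6 + ln t"
      using t by (simp add: ln_mult ln_realpow)
    finally show ?thesis by (simp add: U_def)
  qed
  have lnt: "ln t < 0" using t by simp
  have U0: "U z0 \<ge> 5 / 6" using Uz0 nd A l lnt by linarith
  \<comment> \<open>The maximiser \<open>z1\<close> of \<open>\<Phi>\<close> is a point at which \<open>U\<close> grows by at most a factor \<open>e\<close> within
    distance \<open>1 / \<mu>\<close>; the rate \<open>\<mu>\<close> is large enough to keep \<open>z1\<close> away from the boundary.\<close>
  define \<mu> where "\<mu> = 8 * (2 * l + 1) / d"
  have \<mu>: "\<mu> > 0" using d0 l by (simp add: \<mu>_def)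
  define \<Phi> where "\<Phi> = (\<lambda>w. U w * exp (- \<mu> * dist w z0))"
  have "continuous_on (cball z0 (d / 4)) \<Phi>"
    unfolding \<Phi>_def U_def using low(2) by (intro continuous_intros) auto
  then obtain z1 where z1: "z1 \<in> cball z0 (d / 4)" "\<And>w. w \<in> cball z0 (d / 4) \<Longrightarrow> \<Phi> w \<le> \<Phi> z1"
    using continuous_attains_sup[of "cball z0 (d / 4)" \<Phi>] d0 by force
  have "U z0 \<le> \<Phi> z1" using z1(2)[of z0] d0 by (simp add: \<Phi>_def)
  with U0 have \<Phi>1: "\<Phi> z1 > 0" by simp
  then have U1pos: "U z1 > 0" by (simp add: \<Phi>_def zero_less_mult_iff)
  then have "\<Phi> z1 \<le> U z1" 
    unfolding \<Phi>_def using \<mu> by (intro mult_left_le) auto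
  with \<open>U z0 \<le> \<Phi> z1\<close> have U1: "U z0 \<le> U z1" by simp
  \<comment> \<open>At distance \<open>d / 8\<close> or more the exponential factor is at most
    \<open>exp (- 1) / n\<^sup>2\<close>. Against \<open>U \<le> 4 * n / d\<close> this leaves
    \<open>\<Phi> z1 \<le> 2 / (n * d) \<le> 2 / 5\<close>, below \<open>U z0\<close>.\<close>
  have dz1: "dist z1 z0 < d / 8"
  proof (rule ccontr)
    assume "\<not> dist z1 z0 < d / 8"
    then have "\<mu> * (d / 8) \<le> \<mu> * dist z1 z0" using \<mu> by (intro mult_left_mono) auto
    then have "- \<mu> * dist z1 z0 \<le> - (l + l) - 1" using d0 by (simp add: \<mu>_def)
    then have "exp (- \<mu> * dist z1 z0) \<le> exp (- (l + l) - 1)" by simp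
    also have "\<dots> = exp (- l) * exp (- l) * exp (- 1)"
      by (simp flip: exp_add)
    also have "\<dots> = exp (-1) / (n * n)"
      using n by (simp add: l_def exp_minus field_simps)
    also have "\<dots> \<le> (1 / 2) / (n * n)"
      using exp_ge_add_one_self[of 1] by (intro divide_right_mono) (auto simp: exp_minus field_simps)
    finally have "\<Phi> z1 \<le> (4 * n / d) * ((1 / 2) / (n * n))"
      unfolding \<Phi>_def using U_le[OF z1(1)] U1pos d0 by (intro mult_mono) auto
    also have "\<dots> = 2 / (n * d)" using n d0 by (simp add: field_simps)
    also have "\<dots> \<le> 2 / 5" using nd A l by (intro divide_left_mono) auto
    finally show False using U0 \<open>U z0 \<le> \<Phi> z1\<close> by simp
  qed
  define \<rho> where "\<rho> = 1 / \<mu>"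
  have \<rho>: "\<rho> > 0" "\<rho> \<le> d / 8" using \<mu> d0 l by (simp_all add: \<rho>_def \<mu>_def field_simps)
  have sub: "w \<in> cball z0 (d / 4)" if "w \<in> ball z1 \<rho>" for w
    using that \<rho> dz1 dist_triangle[of z0 w z1] by (simp add: dist_commute)
  \<comment> \<open>Harnack applies with \<open>M = U z1\<close>: within distance
    \<open>\<rho>\<close> of \<open>z1\<close> maximality of \<open>\<Phi>\<close> gives
    \<open>U w \<le> exp 1 * U z1\<close>, and \<open>exp 1 < 3\<close>.\<close>
  have small: "ln (norm (poly p w)) \<le> - U z1 / 2" if "w \<in> ball z1 (\<rho> / 9)" for w
  proof (rule harnack_log_norm[where a = z1 and r = \<rho>, OF _ _ U1pos _ _ that])
    show "poly p holomorphic_on ball z1 \<rho>" by (intro holomorphic_intros)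
    show "ln (norm (poly p z1)) = - U z1" by (simp add: U_def)
    show "poly p w \<noteq> 0" if "w \<in> ball z1 \<rho>" for w using low(2)[OF sub[OF that]] by auto
    show "- 3 * U z1 < ln (norm (poly p w))" if w: "w \<in> ball z1 \<rho>" for w
    proof -
      have "dist w z0 - dist z1 z0 \<le> \<rho>"
        using w dist_triangle[of w z0 z1] by (simp add: dist_commute)
      then have "\<mu> * (dist w z0 - dist z1 z0) \<le> \<mu> * \<rho>" using \<mu> by (intro mult_left_mono) auto
      then have le1: "\<mu> * dist w z0 - \<mu> * dist z1 z0 \<le> 1" using \<mu> by (simp add: \<rho>_def algebra_simps)
      have "U w = \<Phi> w * exp (\<mu> * dist w z0)" by (simp add: \<Phi>_def exp_minus)
      also have "\<dots> \<le> \<Phi> z1 * exp (\<mu> * dist w z0)" using z1(2)[OF sub[OF w]] by simp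
      also have "\<dots> = U z1 * exp (\<mu> * dist w z0 - \<mu> * dist z1 z0)"
        by (simp add: \<Phi>_def exp_diff exp_minus field_simps)
      also have "\<dots> \<le> U z1 * exp 1" using le1 U1pos by simp
      also have "\<dots> < U z1 * 3" using e_less_272 U1pos by (intro mult_strict_left_mono) auto
      finally show ?thesis by (simp add: U_def)
    qed
  qed
  have "ball z1 (1 / (288 * real n)) \<subseteq> lemniscate p t"
  proof
    fix w assume w: "w \<in> ball z1 (1 / (288 * real n))"
    \<comment> \<open>Here \<open>\<rho> / 9 = d / (72 * (2 * l + 1))\<close>, and
      \<open>288 = 4 * 72\<close>. The logarithm in \<open>\<mu>\<close> is compensated by the one
      in \<open>d\<close>.\<close>
    have "(2 * l + 1) / 4 \<le> n * d" using nd A l by simp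
    then have "1 / (288 * real n) \<le> \<rho> / 9" using n l d0 by (simp add: \<rho>_def \<mu>_def field_simps)
    with w have w9: "w \<in> ball z1 (\<rho> / 9)" by simp
    have "- U z1 / 2 \<le> ln t" using U1 Uz0 nd A l by linarith
    with small[OF w9] have "ln (norm (poly p w)) \<le> ln t" by simp
    moreover have "norm (poly p w) > 0" using w9 \<rho> by (intro low(2) sub) auto
    ultimately show "w \<in> lemniscate p t" using t by (simp add: lemniscate_def)
  qed
  then show thesis by (rule that)
qed

section \<open>The lower bound for the area\<close>

lemma lemniscate_area_ge:
  fixes t :: real
  assumes t: "0 < t" "t < 1"
  obtains c where "c > 0" "\<And>n p. n \<ge> 1 \<Longrightarrow> p \<in> monic_polys n (cball 0 1) \<Longrightarrow>
    c / real n ^ 2 \<le> measure lebesgue (lemniscate p t)"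
proof -
  define k where "k = (LINT z|lborel. disc_bump (t\<^sup>2) z)"
  have k: "k > 0" unfolding k_def by (rule integral_disc_bump_pos) (use t in simp)
  define A where "A = max 5 (- 6 * ln t)"
  \<comment> \<open>\<open>c1\<close> serves lemniscates inside the disc of radius
    \<open>1 + d\<close>; \<open>c2\<close> is the area of a disc of radius
    \<open>1 / 288\<close>.\<close>
  define c1 where "c1 = k * t\<^sup>2 / (2 * exp (2 * A))"
  define c2 where "c2 = pi / 288\<^sup>2"
  show thesis
  proof (rule that[of "min c1 c2"])
    show "min c1 c2 > 0" using k t by (simp add: c1_def c2_def)
    fix n :: nat and p :: "complex poly"
    assume n: "n \<ge> 1" and p: "p \<in> monic_polys n (cball 0 1)"
    let ?m = "measure lebesgue (lemniscate p t)"
    \<comment> \<open>The term \<open>ln n / 2\<close> is chosen so that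
      \<open>exp (2 * n * d)\<close> is only \<open>exp (2 * A) * n\<close>.\<close>
    define d where "d = (A + ln n / 2) / n"
    have nd: "n * d = A + ln n / 2" using n by (simp add: d_def)
    have d0: "d \<ge> 0" using n by (simp add: d_def A_def)
    have "c1 / real n ^ 2 \<le> ?m \<or> c2 / real n ^ 2 \<le> ?m"
    proof (cases "lemniscate p t \<subseteq> cball 0 (1 + d)")
      case True
      have "(1 + d) ^ (2 * n) \<le> exp d ^ (2 * n)"
        using d0 exp_ge_add_one_self[of d] by (intro power_mono) auto
      also have "\<dots> = exp (2 * (n * d))" by (simp add: exp_of_nat_mult[symmetric] mult_ac)
      also have "\<dots> = exp (2 * A) * n" using n by (simp add: nd exp_add distrib_left)
      finally have R: "(1 + d) ^ (2 * n) \<le> exp (2 * A) * n" .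
      have "k \<le> n * (2 / t\<^sup>2 * (1 + d) ^ (2 * n) * ?m)"
        unfolding k_def by (rule integral_bump_le_area[OF p n t _ True]) (use d0 in simp)
      also have "\<dots> \<le> n * (2 / t\<^sup>2 * (exp (2 * A) * n) * ?m)"
        using R t by (intro mult_left_mono mult_right_mono) auto
      finally have "c1 / real n ^ 2 \<le> ?m"
        using n t by (simp add: c1_def field_simps power2_eq_square)
      then show ?thesis ..
    next
      case False
      then obtain z where "z \<in> lemniscate p t" "z \<notin> cball 0 (1 + d)" by blast
      then have "z \<in> lemniscate p t" "norm z > 1 + d" by simp_all
      from lemniscate_contains_ball[OF p n t _ _ d_def this]
      obtain c where c: "ball c (1 / (288 * real n)) \<subseteq> lemniscate p t"
        by (auto simp: A_def)
      have "c2 / real n ^ 2 = measure lebesgue (ball c (1 / (288 * real n)))"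
        using n by (simp add: c2_def content_ball unit_ball_vol_2 power_divide power_mult_distrib)
      also have "\<dots> \<le> ?m"
        using compact_lemniscate(1)[OF p n t(2)] c
        by (intro measure_mono_fmeasurable) (auto intro: lmeasurable_compact)
      finally show ?thesis ..
    qed
    then show "min c1 c2 / real n ^ 2 \<le> ?m"
      by (smt (verit) divide_right_mono min.cobounded1 min.cobounded2 zero_le_power of_nat_0_le_iff)
  qed
qed

section \<open>The upper bound and the comparison of the two infima\<close>

lemma monom_minus_one_monic:
  assumes "n \<ge> 1"
  shows "monom 1 n - 1 \<in> monic_polys n (sphere 0 1)"
proof -
  have deg: "degree (monom 1 n - 1 :: complex poly) = n"
    using assms degree_add_eq_left[of "- 1" "monom (1::complex) n"] by (simp add: degree_monom_eq)
  moreover have "coeff (monom 1 n - 1 :: complex poly) n = 1"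
    using assms by (cases n) simp_all
  moreover have "norm z = 1" if "poly (monom 1 n - 1) z = 0" for z :: complex
  proof -
    have "z ^ n = 1" using that by (simp add: poly_monom)
    then have "norm z ^ n = 1 ^ n" by (metis norm_one norm_power power_one)
    then show ?thesis using assms by (intro power_eq_imp_eq_base[of "norm z" n 1]) auto
  qed
  ultimately show ?thesis by (simp add: monic_polys_def)
qed

lemma kappa_le:
  assumes "p \<in> monic_polys n K"
  shows "kappa n K t \<le> measure lebesgue (lemniscate p t)"
  unfolding kappa_def by (rule cINF_lower[OF _ assms]) (auto intro!: bdd_belowI2[of _ 0])

lemma kappa_sphere_le:
  fixes t :: real
  assumes t: "0 < t" "t < 1" and n: "n \<ge> 1"
  shows "kappa n (sphere 0 1) t \<le> pi * (3 + 2 * (- ln (1 - t))) / n"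
proof -
  \<comment> \<open>As \<open>exp (- a) = 1 - t\<close>, any \<open>z\<close> with
    \<open>norm z < 1 - a / n\<close> has \<open>norm z ^ n < 1 - t\<close>.\<close>
  define a where "a = - ln (1 - t)"
  have a: "a > 0" using t by (simp add: a_def)
  let ?p = "monom 1 n - 1 :: complex poly"
  let ?L = "lemniscate ?p t"
  define B where "B = ball (0::complex) (1 - a / n)"
  define D where "D = cball (0::complex) (1 + 1 / n)"
  have sub: "?L \<subseteq> D - B"
  proof
    fix z assume "z \<in> ?L"
    then have z: "norm (z ^ n - 1) \<le> t" by (simp add: lemniscate_def poly_monom)
    have "norm z ^ n \<le> 1 + t" "norm z ^ n \<ge> 1 - t"
      using z norm_triangle_ineq2[of "z ^ n" 1] norm_triangle_ineq2[of 1 "z ^ n"]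
      by (simp_all add: norm_power norm_minus_commute)
    have "norm z ^ n \<le> 1 + real n * (1 / n)" using \<open>norm z ^ n \<le> 1 + t\<close> t n by simp
    also have "\<dots> \<le> (1 + 1 / n) ^ n" by (rule Bernoulli_inequality) (simp add: order_trans[of _ 0])
    finally have "norm z \<le> 1 + 1 / n" using n by (simp add: power_mono_iff)
    moreover have "norm z \<ge> 1 - a / n"
    proof (rule ccontr)
      assume "\<not> norm z \<ge> 1 - a / n"
      then have "norm z < exp (- a / n)" using exp_ge_add_one_self[of "- a / n"] by simp
      then have "norm z ^ n < exp (- a / n) ^ n" using n by (intro power_strict_mono) auto
      also have "\<dots> = 1 - t" using n t by (simp add: exp_of_nat_mult[symmetric] a_def)
      finally show False using \<open>norm z ^ n \<ge> 1 - t\<close> by simp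
    qed
    ultimately show "z \<in> D - B" by (simp add: D_def B_def)
  qed
  have "kappa n (sphere 0 1) t \<le> measure lebesgue ?L"
    by (rule kappa_le[OF monom_minus_one_monic[OF n]])
  also have "\<dots> \<le> measure lebesgue (D - B)"
  proof (rule measure_mono_fmeasurable[OF sub])
    have "?p \<in> monic_polys n (cball 0 1)"
      using monom_minus_one_monic[OF n] by (auto simp: monic_polys_def)
    from compact_lemniscate(1)[OF this n t(2)] show "?L \<in> sets lebesgue"
      using lmeasurable_compact fmeasurableD by blast
    show "D - B \<in> lmeasurable" by (simp add: D_def B_def fmeasurable_Diff)
  qed
  also have "\<dots> = measure lebesgue D - measure lebesgue B"
  proof (rule measurable_measure_Diff)
    show "B \<subseteq> D" using a n 
      unfolding B_def D_def by (intro order_trans[OF ball_subset_cball] subset_cball) (simp add: order_trans[of _ 0])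
  qed (simp_all add: D_def B_def)
  also have "\<dots> \<le> pi * (3 + 2 * a) / n"
  proof -
    have D: "measure lebesgue D = pi * (1 + 1 / n)\<^sup>2"
      by (simp add: D_def content_cball unit_ball_vol_2)
    have "pi * (1 - 2 * a / n) \<le> measure lebesgue B"
    \<comment> \<open>For \<open>a > n\<close> the radius of \<open>B\<close> is negative and the
      disc area formula fails, but then the claimed lower bound is nonpositive.\<close>
    proof (cases "a \<le> n")
      case True
      then have "measure lebesgue B = pi * (1 - a / n)\<^sup>2"
        using n by (simp add: B_def content_ball unit_ball_vol_2)
      moreover have "1 - 2 * a / n \<le> (1 - a / n)\<^sup>2"
        by (simp add: power2_eq_square algebra_simps)
      ultimately show ?thesis by simp
    next
      case False
      then have "1 - 2 * a / n \<le> 0" using n a by (simp add: field_simps)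
      then have "pi * (1 - 2 * a / n) \<le> 0" by (simp add: mult_nonneg_nonpos)
      then show ?thesis using measure_nonneg order_trans by blast
    qed
    moreover have "(1 + 1 / n)\<^sup>2 \<le> 1 + 3 / n"
    proof -
      have "1 / n * (1 / n) \<le> 1 / n * 1" using n by (intro mult_left_mono) auto
      then show ?thesis by (simp add: power2_eq_square algebra_simps)
    qed
    then have "pi * (1 + 1 / n)\<^sup>2 \<le> pi * (1 + 3 / n)" by simp
    ultimately have "measure lebesgue D - measure lebesgue B \<le> pi * (1 + 3 / n) - pi * (1 - 2 * a / n)"
      using D by linarith
    also have "\<dots> = pi * (3 + 2 * a) / n" by (simp add: algebra_simps add_divide_distrib)
    finally show ?thesis .
  qed
  finally show ?thesis by (simp add: a_def)
qed

text \<open>Nonemptiness matters because the real \<open>Inf\<close> of the empty set is not its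
  true infimum.\<close>

lemma kappa_mono:
  assumes "monic_polys n K \<noteq> {}" "K \<subseteq> K'"
  shows "kappa n K' t \<le> kappa n K t"
  unfolding kappa_def
  using assms by (intro cINF_superset_mono) (auto simp: monic_polys_def intro!: bdd_belowI2[of _ 0])

theorem theorem3:
  fixes t :: real
  assumes "0 < t" and "t < 1"
  shows "\<exists>c C :: real. 0 < c \<and> c < C \<and>
    (\<forall>n::nat. n \<ge> 1 \<longrightarrow>
       c / real n ^ 4 \<le> kappa n (cball 0 1) t \<and>
       kappa n (cball 0 1) t \<le> kappa n (sphere 0 1) t \<and>
       kappa n (sphere 0 1) t \<le> C / real n) \<and>
    (\<forall>n::nat. n \<ge> 2 \<longrightarrow>
       kappa n (sphere 0 1) t \<ge> c / (real n ^ 2 * ln (real n)))"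
proof -
  obtain c where c: "c > 0" "\<And>n p. n \<ge> 1 \<Longrightarrow> p \<in> monic_polys n (cball 0 1) \<Longrightarrow>
      c / real n ^ 2 \<le> measure lebesgue (lemniscate p t)"
    using lemniscate_area_ge[OF assms] by metis
  define C where "C = pi * (3 + 2 * (- ln (1 - t)))"
  \<comment> \<open>One constant for both lower bounds: \<open>ln 2 \<le> 1\<close> gives
    \<open>c' \<le> c\<close>, and \<open>ln 2 \<le> ln n\<close> for \<open>n \<ge> 2\<close>
    absorbs the logarithm.\<close>
  define c' where "c' = c * ln 2"
  have ln2: "0 < ln (2::real)" "ln (2::real) \<le> 1"
    using ln_le_minus_one[of 2] by simp_all
  have c': "0 < c'" "c' \<le> c"
    using c(1) ln2 by (simp_all add: c'_def mult_left_le)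
  have ne: "monic_polys n (sphere 0 1) \<noteq> {}" if "n \<ge> 1" for n
    using monom_minus_one_monic[OF that] by blast
  have mono: "kappa n (cball 0 1) t \<le> kappa n (sphere 0 1) t" if "n \<ge> 1" for n
    using ne[OF that] by (intro kappa_mono) auto
  have lower: "c / real n ^ 2 \<le> kappa n (cball 0 1) t" if n: "n \<ge> 1" for n
    unfolding kappa_def
  proof (rule cINF_greatest)
    show "monic_polys n (cball 0 1) \<noteq> {}"
      using ne[OF n] by (force simp: monic_polys_def)
  qed (rule c(2)[OF n])
  \<comment> \<open>The maximum with \<open>c' + 1\<close> secures \<open>c' < C\<close> in the
    final statement.\<close>
  have upper: "kappa n (sphere 0 1) t \<le> max C (c' + 1) / n" if "n \<ge> 1" for n
    using kappa_sphere_le[OF assms that]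
    by (rule order_trans) (auto simp: C_def intro!: divide_right_mono)
  have lower4: "c' / real n ^ 4 \<le> kappa n (cball 0 1) t" if n: "n \<ge> 1" for n
  proof -
    have "c' / real n ^ 4 \<le> c / real n ^ 2"
      using c' n by (intro frac_le power_increasing) auto
    with lower[OF n] show ?thesis by simp
  qed
  have lowerlog: "c' / (real n ^ 2 * ln n) \<le> kappa n (sphere 0 1) t" if n: "n \<ge> 2" for n
  proof -
    have "ln 2 \<le> ln (real n)" using n by simp
    have "c' / (real n ^ 2 * ln n) \<le> c * ln n / (real n ^ 2 * ln n)"
      using c(1) n unfolding c'_def by (intro divide_right_mono mult_left_mono) auto
    also have "\<dots> = c / real n ^ 2" using n by simp
    also have "\<dots> \<le> kappa n (cball 0 1) t" using lower n by simp
    also have "\<dots> \<le> kappa n (sphere 0 1) t" using mono n by simp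
    finally show ?thesis .
  qed
  show ?thesis
    by (rule exI[of _ c'], rule exI[of _ "max C (c' + 1)"])
       (use c'(1) mono upper lower4 lowerlog in auto)
qed

end
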